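(* Let $\delta\le\delta'$ (component-wise) be two increment functions of size $n$. Let $P\triangleleft Q$ be a covering relation in $\operatorname{Tam}^{\delta'}_n$. Then $P<Q$ in $\operatorname{Tam}^{\delta}_n$.
   Context: $P\triangleleft Q$ denotes a covering relation: $P<Q$ with no element strictly between. Dyck paths. A Dyck path of size (or length) $n$ is a word with $n$ letters $u$ (up steps) and $n$ letters $d$ (down steps) such that every prefix contains at least as many $u$ as $d$. Its up steps are numbered $u_1,\dots,u_n$ from left to right. A subword is a portion of consecutive letters. A valley is a down step immediately followed by an up step. Alt-Tamari posets. An increment function of size $n$ is a function $\delta\colon\{1,\dots,n\}\to\{0,1\}$. Put $\delta(u_i)=\delta(i)$, $\delta(d)=-1$, and $\delta(A)=\sum_{s\in A}\delta(s)$ for a subword $A$ of a Dyck path $P$ of size $n$. The $\delta$-excursion of $u_i$ in $P$ is the smallest (nonempty) subword $C_i$ of $P$ starting with $u_i$ such that $\delta(C_i)=0$ (it always exists). If $P$ has a valley $du_i$, the $\delta$-rotation of $P$ at $u_i$ is the Dyck path $Q$ obtained by exchanging the down step preceding $u_i$ with the $\delta$-excursion $C_i$ of $u_i$: $P=A\,d\,C_i\,B$ and $Q=A\,C_i\,d\,B$. The alt-Tamari poset $\operatorname{Tam}^\delta_n$ is the set of Dyck paths of size $n$ with the order given by the reflexive transitive closure of the relation "$Q$ is a $\delta$-rotation of $P$" (with $P$ below $Q$); this is a partial order. *)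

theory Defs
  imports Main "HOL-Library.FuncSet" "HOL-Library.Sublist"
begin

datatype step = Up | Down

definition dyck_paths :: "nat \<Rightarrow> step list set" where
  "dyck_paths n = {P. count_list P Up = n \<and> count_list P Down = n \<and>
     (\<forall>A. prefix A P \<longrightarrow> count_list A Down \<le> count_list A Up)}"

text \<open>Only the values on \<open>{1..n}\<close> matter; integer values, since weights of subwords can be negative.\<close>

definition increment_function :: "nat \<Rightarrow> (nat \<Rightarrow> int) \<Rightarrow> bool" where
  "increment_function n \<delta> \<longleftrightarrow> \<delta> \<in> {1..n} \<rightarrow> {0, 1}"

text \<open>\<open>weight \<delta> k C\<close> is \<open>\<delta>(C)\<close> for a subword \<open>C\<close> of a path that is preceded in the path by
  exactly \<open>k\<close> up steps, so that the up steps of \<open>C\<close> are numbered \<open>k + 1, k + 2, \<dots>\<close>\<close>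

fun weight :: "(nat \<Rightarrow> int) \<Rightarrow> nat \<Rightarrow> step list \<Rightarrow> int" where
  "weight \<delta> k [] = 0"
| "weight \<delta> k (Up # C) = \<delta> (Suc k) + weight \<delta> (Suc k) C"
| "weight \<delta> k (Down # C) = - 1 + weight \<delta> k C"

text \<open>\<open>is_excursion \<delta> P i A C B\<close>: in the decomposition \<open>P = A C B\<close>, the middle part starts with the
  \<open>i\<close>-th up step of \<open>P\<close> and is the \<open>\<delta>\<close>-excursion of that step. Subwords with the same first letter
  are ordered by the prefix relation, hence the form of minimality.\<close>

definition is_excursion ::
  "(nat \<Rightarrow> int) \<Rightarrow> step list \<Rightarrow> nat \<Rightarrow> step list \<Rightarrow> step list \<Rightarrow> step list \<Rightarrow> bool" where
  "is_excursion \<delta> P i A C B \<longleftrightarrow>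
     P = A @ C @ B \<and> prefix [Up] C \<and> i = Suc (count_list A Up) \<and>
     weight \<delta> (count_list A Up) C = 0 \<and>
     (\<forall>C'. strict_prefix C' C \<and> C' \<noteq> [] \<longrightarrow> weight \<delta> (count_list A Up) C' \<noteq> 0)"

definition rotation_at :: "(nat \<Rightarrow> int) \<Rightarrow> nat \<Rightarrow> step list \<Rightarrow> step list \<Rightarrow> bool" where
  "rotation_at \<delta> i P Q \<longleftrightarrow>
     (\<exists>A C B. is_excursion \<delta> P i (A @ [Down]) C B \<and> Q = A @ C @ [Down] @ B)"

definition rotations :: "nat \<Rightarrow> (nat \<Rightarrow> int) \<Rightarrow> step list rel" where
  "rotations n \<delta> =
     {(P, Q). P \<in> dyck_paths n \<and> Q \<in> dyck_paths n \<and> (\<exists>i\<in>{1..n}. rotation_at \<delta> i P Q)}"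

text \<open>The order relation of the alt-Tamari poset. The relation \<open>(rotations n \<delta>)\<^sup>*\<close> is reflexive on all
  words, so it is restricted to the carrier \<open>dyck_paths n\<close>.\<close>

definition alt_tamari :: "nat \<Rightarrow> (nat \<Rightarrow> int) \<Rightarrow> step list rel" where
  "alt_tamari n \<delta> = (rotations n \<delta>)\<^sup>* \<inter> (dyck_paths n \<times> dyck_paths n)"

definition less_in :: "'a rel \<Rightarrow> 'a \<Rightarrow> 'a \<Rightarrow> bool" where
  "less_in r x y \<longleftrightarrow> (x, y) \<in> r \<and> x \<noteq> y"

definition covers_in :: "'a rel \<Rightarrow> 'a \<Rightarrow> 'a \<Rightarrow> bool" where
  "covers_in r x y \<longleftrightarrow> less_in r x y \<and> \<not> (\<exists>z. less_in r x z \<and> less_in r z y)"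

end

theory Submission
  imports Defs
begin

text \<open>
  Every \<open>\<delta>'\<close>-rotation is a composition of \<open>\<delta>\<close>-rotations, which gives the inclusion of the two orders.
  Let the \<open>\<delta>'\<close>-rotation replace \<open>A d C B\<close> by \<open>A C d B\<close>. Weights drop by at most one per letter, so
  every prefix of the \<open>\<delta>'\<close>-excursion \<open>C\<close> has nonnegative \<open>\<delta>'\<close>-weight; as \<open>\<delta>'(C) = 0\<close>, every suffix
  of \<open>C\<close> has nonpositive \<open>\<delta>'\<close>-weight, hence also nonpositive \<open>\<delta>\<close>-weight
  (lemma \<open>excursion_suffix_weight_nonpos\<close>). Consequently, wherever a suffix of \<open>C\<close> starts with an up
  step, the \<open>\<delta>\<close>-excursion of that step ends within \<open>C\<close>. So \<open>C\<close> is a concatenation of down steps and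
  \<open>\<delta>\<close>-excursions, and the down step preceding \<open>C\<close> can be moved through \<open>C\<close> piece by piece: past an
  excursion by a \<open>\<delta>\<close>-rotation, and past a down step without changing the word
  (lemma \<open>move_Down_past\<close>). Strictness is immediate, since \<open>P \<noteq> Q\<close> does not depend on the order.
\<close>

lemma weight_append:
  "weight \<delta> k (C @ D) = weight \<delta> k C + weight \<delta> (k + count_list C Up) D"
  by (induction \<delta> k C rule: weight.induct) auto

lemma weight_mono:
  assumes "\<forall>i\<in>{k<..k + count_list C Up}. \<delta> i \<le> \<delta>' i"
  shows "weight \<delta> k C \<le> weight \<delta>' k C"
  using assms
proof (induction \<delta> k C rule: weight.induct)
  case (2 \<delta> k C)
  have "weight \<delta> (Suc k) C \<le> weight \<delta>' (Suc k) C"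
    using "2.prems" by (intro "2.IH") auto
  moreover have "\<delta> (Suc k) \<le> \<delta>' (Suc k)"
    using "2.prems" by auto
  ultimately show ?case by simp
qed auto

text \<open>A discrete intermediate value property: partial sums start at \<open>x \<ge> 0\<close> and drop by at most one
  per letter, so they cannot reach a nonpositive value without meeting \<open>0\<close>.\<close>

lemma first_zero_prefix:
  assumes "0 \<le> x" "x + weight \<delta> k C \<le> 0"
    and "\<forall>i\<in>{k<..k + count_list C Up}. 0 \<le> \<delta> i"
  obtains D E where "C = D @ E" "x + weight \<delta> k D = 0"
    "\<And>D'. strict_prefix D' D \<Longrightarrow> x + weight \<delta> k D' \<noteq> 0"
proof -
  have "\<exists>D E. C = D @ E \<and> x + weight \<delta> k D = 0 \<and>
    (\<forall>D'. strict_prefix D' D \<longrightarrow> x + weight \<delta> k D' \<noteq> 0)"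
    using assms
  proof (induction C arbitrary: x k)
    case Nil
    then show ?case by auto
  next
    case (Cons s C)
    show ?case
    proof (cases "x = 0")
      case True
      then show ?thesis by fastforce
    next
      case False
      define y l where "y = x + weight \<delta> k [s]" and "l = k + count_list [s] Up"
      have split: "x + weight \<delta> k (s # F) = y + weight \<delta> l F" for F
        using weight_append[of \<delta> k "[s]" F] by (simp add: y_def l_def)
      have "0 \<le> y"
        using Cons.prems(1,3) \<open>x \<noteq> 0\<close> by (cases s) (auto simp: y_def)
      moreover have "y + weight \<delta> l C \<le> 0"
        using Cons.prems(2) split by simp
      moreover have "\<forall>i\<in>{l<..l + count_list C Up}. 0 \<le> \<delta> i"
        using Cons.prems(3) by (auto simp: l_def split: if_splits)
      ultimately obtain D E where DE: "C = D @ E" "y + weight \<delta> l D = 0"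
        "\<forall>D'. strict_prefix D' D \<longrightarrow> y + weight \<delta> l D' \<noteq> 0"
        using Cons.IH by blast
      have "x + weight \<delta> k D' \<noteq> 0" if "strict_prefix D' (s # D)" for D'
      proof (cases D')
        case Nil
        then show ?thesis using False by simp
      next
        case (Cons t D'')
        then show ?thesis using that DE(3) split by auto
      qed
      then show ?thesis
        using DE split by (intro exI[of _ "s # D"] exI[of _ E]) auto
    qed
  qed
  then show thesis using that by blast
qed

text \<open>If the letters from an up step to the end of a word have nonpositive weight, the excursion of
  that step ends within the word, and so it is the same for every continuation \<open>B\<close>.\<close>

lemma excursion_within:
  assumes "weight \<delta> (count_list A Up) (Up # C) \<le> 0"
    and "\<forall>i\<in>{count_list A Up<..count_list A Up + Suc (count_list C Up)}. 0 \<le> \<delta> i"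
  obtains D E where "Up # C = D @ E" "D \<noteq> []"
    "\<And>B. is_excursion \<delta> (A @ D @ B) (Suc (count_list A Up)) A D B"
proof -
  let ?k = "count_list A Up"
  have "0 \<le> \<delta> (Suc ?k)"
    using assms(2) by auto
  moreover have "\<delta> (Suc ?k) + weight \<delta> (Suc ?k) C \<le> 0"
    using assms(1) by simp
  moreover have "\<forall>i\<in>{Suc ?k<..Suc ?k + count_list C Up}. 0 \<le> \<delta> i"
    using assms(2) by auto
  ultimately obtain D E where DE: "C = D @ E" "\<delta> (Suc ?k) + weight \<delta> (Suc ?k) D = 0"
    and min: "\<And>D'. strict_prefix D' D \<Longrightarrow> \<delta> (Suc ?k) + weight \<delta> (Suc ?k) D' \<noteq> 0"
    by (rule first_zero_prefix) blast
  have "weight \<delta> ?k C' \<noteq> 0" if C': "strict_prefix C' (Up # D)" "C' \<noteq> []" for C'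
  proof -
    obtain D' where "C' = Up # D'" "strict_prefix D' D"
      using C' by (cases C') auto
    then show ?thesis using min by simp
  qed
  then have "is_excursion \<delta> (A @ (Up # D) @ B) (Suc ?k) A (Up # D) B" for B
    using DE by (simp add: is_excursion_def)
  then show thesis
    using that[of "Up # D" E] DE(1) by simp
qed

lemma excursion_suffix_weight_nonpos:
  assumes exc: "is_excursion \<delta> P i A C B" and C: "C = D @ E"
    and nonneg: "\<forall>j\<in>{count_list A Up<..count_list A Up + count_list C Up}. 0 \<le> \<delta> j"
  shows "weight \<delta> (count_list A Up + count_list D Up) E \<le> 0"
proof -
  let ?k = "count_list A Up"
  have "0 \<le> weight \<delta> ?k D"
  proof (rule ccontr)
    assume "\<not> 0 \<le> weight \<delta> ?k D"
    then have neg: "weight \<delta> ?k D < 0" by simp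
    then have "D \<noteq> []" by auto
    then obtain D0 where D0: "D = Up # D0"
      using exc C by (cases D) (auto simp: is_excursion_def)
    \<comment> \<open>The excursion would have to end before the weight becomes negative.\<close>
    obtain F G where FG: "D = F @ G" "F \<noteq> []"
      and F: "is_excursion \<delta> (A @ F @ []) (Suc ?k) A F []"
    proof (rule excursion_within[of \<delta> A D0])
      show "weight \<delta> ?k (Up # D0) \<le> 0" using neg D0 by simp
      show "\<forall>i\<in>{?k<..?k + Suc (count_list D0 Up)}. 0 \<le> \<delta> i"
        using nonneg C D0 by auto
    qed (use that D0 in blast)
    have F0: "weight \<delta> ?k F = 0"
      using F by (simp add: is_excursion_def)
    then have "G \<noteq> []"
      using neg FG(1) by auto
    then have "strict_prefix F C"
      using C FG by (auto simp: strict_prefix_def)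
    then show False
      using exc F0 FG(2) by (auto simp: is_excursion_def)
  qed
  moreover have "weight \<delta> ?k D + weight \<delta> (?k + count_list D Up) E = 0"
    using exc C by (simp add: is_excursion_def weight_append)
  ultimately show ?thesis by simp
qed

lemma dyck_path_move_Down:
  assumes P: "A @ Down # C @ B \<in> dyck_paths n"
  shows "A @ C @ Down # B \<in> dyck_paths n"
proof -
  have pre: "count_list X Down \<le> count_list X Up" if "prefix X (A @ Down # C @ B)" for X
    using P that by (auto simp: dyck_paths_def)
  have "count_list X Down \<le> count_list X Up" if X: "prefix X (A @ C @ Down # B)" for X
  proof -
    consider "prefix X A" | Y where "X = A @ Y" "prefix Y C"
      | Y where "X = A @ C @ Down # Y" "prefix Y B"
      using X by (auto simp: prefix_append prefix_Cons)
    then show ?thesis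
    proof cases
      case 1
      then show ?thesis using pre[of X] by (simp add: prefix_append)
    next
      case 2
      then show ?thesis using pre[of "A @ Down # Y"] by (simp add: prefix_append)
    next
      case 3
      then show ?thesis using pre[of "A @ Down # C @ Y"] by simp
    qed
  qed
  then show ?thesis
    using P by (auto simp: dyck_paths_def)
qed

lemma move_Down_past:
  assumes "A @ Down # C @ B \<in> dyck_paths n"
    and nonneg: "\<forall>i\<in>{1..n}. 0 \<le> \<delta> i"
    and "\<And>D E. C = D @ E \<Longrightarrow> weight \<delta> (count_list A Up + count_list D Up) E \<le> 0"
  shows "(A @ Down # C @ B, A @ C @ Down # B) \<in> (rotations n \<delta>)\<^sup>*"
  using assms(1,3)
proof (induction "length C" arbitrary: A C rule: less_induct)
  case less
  note P = less.prems(1) and suffix = less.prems(2)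
  consider "C = []" | C' where "C = Down # C'" | C' where "C = Up # C'"
    by (metis list.exhaust step.exhaust)
  then show ?case
  proof cases
    case 1
    then show ?thesis by simp
  next
    case 2
    have "weight \<delta> (count_list (A @ [Down]) Up + count_list D Up) E \<le> 0"
      if "C' = D @ E" for D E
      using suffix[of "Down # D" E] that 2 by simp
    then show ?thesis
      using less.hyps[of C' "A @ [Down]"] P 2 by simp
  next
    case 3
    have n: "count_list A Up + Suc (count_list C' Up) \<le> n"
      using P 3 by (auto simp: dyck_paths_def)
    obtain D E where DE: "Up # C' = D @ E" "D \<noteq> []"
      and exc: "\<And>B. is_excursion \<delta> ((A @ [Down]) @ D @ B) (Suc (count_list (A @ [Down]) Up))
        (A @ [Down]) D B"
    proof (rule excursion_within[of \<delta> "A @ [Down]" C'])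
      show "weight \<delta> (count_list (A @ [Down]) Up) (Up # C') \<le> 0"
        using suffix[of "[]" C] 3 by simp
      show "\<forall>i\<in>{count_list (A @ [Down]) Up<..count_list (A @ [Down]) Up +
          Suc (count_list C' Up)}. 0 \<le> \<delta> i"
        using nonneg n by auto
    qed (rule that)
    have C: "C = D @ E" using 3 DE by simp
    have mid: "A @ D @ Down # E @ B \<in> dyck_paths n"
      using dyck_path_move_Down[of A D "E @ B"] P C by simp
    have "rotation_at \<delta> (Suc (count_list A Up)) (A @ Down # C @ B) (A @ D @ Down # E @ B)"
      unfolding rotation_at_def
      using exc[of "E @ B"] C by (intro exI[of _ A] exI[of _ D] exI[of _ "E @ B"]) simp
    moreover have "Suc (count_list A Up) \<in> {1..n}"
      using n by simp
    ultimately have "(A @ Down # C @ B, A @ D @ Down # E @ B) \<in> rotations n \<delta>"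
      using P mid unfolding rotations_def by blast
    moreover have "((A @ D) @ Down # E @ B, (A @ D) @ E @ Down # B) \<in> (rotations n \<delta>)\<^sup>*"
    proof (rule less.hyps)
      show "length E < length C" using C DE(2) by simp
      show "(A @ D) @ Down # E @ B \<in> dyck_paths n" using mid by simp
      show "weight \<delta> (count_list (A @ D) Up + count_list F Up) G \<le> 0" if "E = F @ G" for F G
        using suffix[of "D @ F" G] that C by (simp add: add.assoc)
    qed
    ultimately show ?thesis
      using C by (simp add: converse_rtrancl_into_rtrancl)
  qed
qed

lemma rotations_subset_rtrancl:
  assumes "\<forall>i\<in>{1..n}. 0 \<le> \<delta> i" and le: "\<forall>i\<in>{1..n}. \<delta> i \<le> \<delta>' i"
  shows "rotations n \<delta>' \<subseteq> (rotations n \<delta>)\<^sup>*"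
proof (rule subrelI)
  fix P Q assume "(P, Q) \<in> rotations n \<delta>'"
  then obtain i A C B where P: "P \<in> dyck_paths n"
    and exc: "is_excursion \<delta>' P i (A @ [Down]) C B" and Q: "Q = A @ C @ [Down] @ B"
    by (auto simp: rotations_def rotation_at_def)
  have P_eq: "P = A @ Down # C @ B"
    using exc by (simp add: is_excursion_def)
  have n: "count_list A Up + count_list C Up \<le> n"
    using P by (auto simp: P_eq dyck_paths_def)
  have "weight \<delta> (count_list A Up + count_list D Up) E \<le> 0" if C: "C = D @ E" for D E
  proof -
    have "weight \<delta> (count_list A Up + count_list D Up) E
        \<le> weight \<delta>' (count_list A Up + count_list D Up) E"
      using le n C by (intro weight_mono) auto
    also have "\<dots> \<le> 0"
    proof -
      have "\<forall>j\<in>{count_list (A @ [Down]) Up<..count_list (A @ [Down]) Up + count_list C Up}.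
          0 \<le> \<delta>' j"
      proof
        fix j assume "j \<in> {count_list (A @ [Down]) Up<..count_list (A @ [Down]) Up + count_list C Up}"
        then have "j \<in> {1..n}" using n by auto
        then show "0 \<le> \<delta>' j" using assms by (meson order_trans)
      qed
      then show ?thesis
        using excursion_suffix_weight_nonpos[OF exc C] by simp
    qed
    finally show ?thesis .
  qed
  then show "(P, Q) \<in> (rotations n \<delta>)\<^sup>*"
    using move_Down_past[of A C B n \<delta>] P assms(1) by (simp add: P_eq Q)
qed

theorem proposition4p10:
  fixes n :: nat and \<delta> \<delta>' :: "nat \<Rightarrow> int" and P Q :: "step list"
  assumes "increment_function n \<delta>" and "increment_function n \<delta>'"
    and "\<forall>i\<in>{1..n}. \<delta> i \<le> \<delta>' i"
    and "covers_in (alt_tamari n \<delta>') P Q"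
  shows "less_in (alt_tamari n \<delta>) P Q"
proof -
  have "\<forall>i\<in>{1..n}. 0 \<le> \<delta> i"
  proof
    fix i assume "i \<in> {1..n}"
    then have "\<delta> i \<in> {0, 1}"
      using assms(1) unfolding increment_function_def by (rule Pi_mem[rotated])
    then show "0 \<le> \<delta> i" by auto
  qed
  then have "(rotations n \<delta>')\<^sup>* \<subseteq> (rotations n \<delta>)\<^sup>*"
    using rotations_subset_rtrancl assms(3) by (intro rtrancl_subset_rtrancl) blast
  then show ?thesis
    using assms(4) by (auto simp: covers_in_def less_in_def alt_tamari_def)
qed

end
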